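(* Let $n\ge r\ge 1$ be integers, $q$ a prime power, and let $K\subseteq\mathbb{F}_q^n$ be a Kakeya set of rank $r$. Then $$|K|\ge\left(\frac{q^{r+1}}{q^r+q-1}\right)^n=\big(1+(q-1)q^{-r}\big)^{-n}q^n.$$
   Context: $\mathbb{F}_q$ denotes the finite field with $q$ elements. For a finite vector space $V$ and an integer $0\le r\le\dim V$, a subset $K\subseteq V$ is a Kakeya set of rank $r$ if for every subspace $L\le V$ with $\dim L=r$ there exists $v\in V$ such that $v+L\subseteq K$. *)

theory Defs
  imports "HOL-Analysis.Analysis"
begin

text \<open>The ambient space \<open>V\<close> is the whole type \<^typ>\<open>'b\<close>.  The notion is intended for finite \<open>V\<close>
  and \<open>r \<le> dim V\<close>: for \<open>r > dim V\<close> the condition would be vacuous.\<close>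

definition (in vector_space) kakeya_set :: "nat \<Rightarrow> 'b set \<Rightarrow> bool" where
  "kakeya_set r K \<longleftrightarrow> (\<forall>L. subspace L \<and> dim L = r \<longrightarrow> (\<exists>v. (+) v ` L \<subseteq> K))"

end

theory Submission
  imports Defs "HOL-Algebra.Algebraic_Closure_Type"
begin

text \<open>
  This is the method of multiplicities. Let \<open>F\<close> be the field with \<open>q^r\<close> elements. Linear algebra
  yields a nonzero polynomial \<open>P\<close> of degree at most \<open>D\<close> that vanishes to order \<open>m\<close> on \<open>K\<close>, as soon
  as \<open>|K|\<close> is smaller than a quotient of two binomial coefficients. For \<open>s \<in> F^n\<close> the values of
  \<open>t \<mapsto> (\<Sum>k<r. (s_i^q t)^(q^k))_i\<close> for \<open>t \<in> F\<close> are traces, hence form a subspace of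
  dimension at most \<open>r\<close> over the base field, so a translate of this curve maps \<open>F\<close> into \<open>K\<close>. The
  curve has degree \<open>q^(r-1)\<close> with leading coefficient \<open>s\<close>. A Hasse derivative of \<open>P\<close> of small order,
  composed with the curve, has too many zeros for its degree, so it is zero, and its leading
  coefficient says that the same derivative of the top homogeneous part of \<open>P\<close> vanishes at \<open>s\<close>.
  Thus the top part vanishes to high order on the whole grid \<open>F^n\<close>, which its degree does not allow.
  With \<open>m = N (q^r + q - 1)\<close>, \<open>D = N q^(r+1) - 1\<close> and order \<open>N q\<close> on the grid, letting \<open>N\<close> tend to
  infinity gives the bound.
\<close>

hide_const (open) Coset.order module.smult up_ring.coeff up_ring.monom
  Polynomials.degree Polynomials.lead_coeff

section \<open>Linear systems and zeros of univariate polynomials\<close>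

lemma exists_nontrivial_solution:
  fixes A :: "'v \<Rightarrow> 'u \<Rightarrow> 'f::field"
  assumes "finite V" "finite U" "card V < card U"
  shows "\<exists>c. (\<exists>u\<in>U. c u \<noteq> 0) \<and> (\<forall>v\<in>V. (\<Sum>u\<in>U. c u * A v u) = 0)"
  using assms
proof (induction V arbitrary: U A rule: finite_induct)
  case empty
  then have "U \<noteq> {}" by auto
  then show ?case by (intro exI[of _ "\<lambda>_. 1"]) auto
next
  case (insert v V)
  show ?case
  proof (cases "\<forall>u\<in>U. A v u = 0")
    case True
    have "card V < card U" using insert.prems insert.hyps by simp
    from insert.IH[OF insert.prems(1) this, of A] obtain c where
      "\<exists>u\<in>U. c u \<noteq> 0" "\<forall>v\<in>V. (\<Sum>u\<in>U. c u * A v u) = 0" by auto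
    with True show ?thesis by (intro exI[of _ c]) auto
  next
    case False
    then obtain u0 where u0: "u0 \<in> U" "A v u0 \<noteq> 0" by auto
    define U' where "U' = U - {u0}"
    have fin: "finite U'" and cU': "card V < card U'"
      using insert.prems insert.hyps u0 by (auto simp: U'_def)
    \<comment> \<open>Gaussian elimination: equation \<open>v\<close> is solved for the unknown at
      \<open>u0\<close>, and this matrix is what the substitution leaves of the other
      equations.\<close>
    from insert.IH[OF fin cU', of "\<lambda>w u. A w u - A w u0 * A v u / A v u0"] obtain c where
      c: "\<exists>u\<in>U'. c u \<noteq> 0"
        "\<And>w. w \<in> V \<Longrightarrow> (\<Sum>u\<in>U'. c u * (A w u - A w u0 * A v u / A v u0)) = 0" by auto
    define d where "d = c(u0 := - (\<Sum>u\<in>U'. c u * A v u) / A v u0)"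
    have sum_d: "(\<Sum>u\<in>U. d u * A w u) = (\<Sum>u\<in>U'. c u * (A w u - A w u0 * A v u / A v u0))" for w
    proof -
      have "(\<Sum>u\<in>U. d u * A w u) = d u0 * A w u0 + (\<Sum>u\<in>U'. d u * A w u)"
        unfolding U'_def using insert.prems(1) u0(1) by (rule sum.remove)
      also have "(\<Sum>u\<in>U'. d u * A w u) = (\<Sum>u\<in>U'. c u * A w u)"
        by (rule sum.cong) (auto simp: d_def U'_def)
      finally show ?thesis
        by (simp add: d_def sum_subtractf algebra_simps sum_distrib_left sum_divide_distrib)
    qed
    have "(\<Sum>u\<in>U. d u * A v u) = 0"
      unfolding sum_d using u0(2) by simp
    moreover have "\<exists>u\<in>U. d u \<noteq> 0"
      using c(1) by (auto simp: d_def U'_def)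
    ultimately show ?thesis
      using c(2) by (intro exI[of _ d]) (auto simp: sum_d)
  qed
qed

text \<open>Zeros counted with multiplicity cannot outnumber the degree. Dividing out the power at
  one point does not change the orders at the others.\<close>

lemma poly_eq_0_if_power_dvd:
  fixes p :: "'f::field poly"
  assumes "finite T" "\<And>t. t \<in> T \<Longrightarrow> [:- t, 1:] ^ k dvd p" "degree p < k * card T"
  shows "p = 0"
  using assms
proof (induction T arbitrary: p rule: finite_induct)
  case (insert t T)
  show ?case
  proof (rule ccontr)
    assume "p \<noteq> 0"
    obtain p' where p': "p = [:- t, 1:] ^ k * p'"
      using insert.prems(1)[of t] by (auto elim: dvdE)
    with \<open>p \<noteq> 0\<close> have "p' \<noteq> 0" by auto
    have "[:- u, 1:] ^ k dvd p'" if "u \<in> T" for u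
    proof -
      have "u \<noteq> t" using that insert.hyps by auto
      have "k \<le> order u p"
        using insert.prems(1)[of u] that \<open>p \<noteq> 0\<close> by (simp add: order_divides)
      also have "order u p = order u ([:- t, 1:] ^ k) + order u p'"
        using \<open>p \<noteq> 0\<close> unfolding p' by (intro order_mult)
      also have "order u ([:- t, 1:] ^ k) = 0"
        using \<open>u \<noteq> t\<close> by (intro order_0I) auto
      finally show ?thesis by (simp add: order_divides)
    qed
    moreover have "degree p = k + degree p'"
      unfolding p' using \<open>p' \<noteq> 0\<close> by (subst degree_mult_eq) (auto simp: degree_linear_power)
    then have "degree p' < k * card T"
      using insert.prems(2) insert.hyps by simp
    ultimately have "p' = 0" by (rule insert.IH)
    with \<open>p' \<noteq> 0\<close> show False by simp
  qed
qed auto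

text \<open>Formal top coefficients at a degree bound are tracked instead of
  \<open>lead_coeff\<close>, because the curves used later have a prescribed top coefficient that
  may be zero.\<close>

lemma degree_le_mult_coeff_mult:
  fixes p q :: "'f::comm_semiring_1 poly"
  assumes "degree p \<le> m" "degree q \<le> n"
  shows "degree (p * q) \<le> m + n \<and> coeff (p * q) (m + n) = coeff p m * coeff q n"
proof
  show "degree (p * q) \<le> m + n"
    using degree_mult_le[of p q] assms by linarith
  have "coeff (p * q) (m + n) = (\<Sum>i\<in>{m}. coeff p i * coeff q (m + n - i))"
    unfolding coeff_mult
  proof (rule sum.mono_neutral_right, simp, simp, intro ballI)
    fix i assume i: "i \<in> {..m + n} - {m}"
    show "coeff p i * coeff q (m + n - i) = 0"
    proof (cases "i < m")
      case True
      with assms show ?thesis by (simp add: coeff_eq_0)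
    next
      case False
      with i have "m < i" by auto
      with assms show ?thesis by (simp add: coeff_eq_0)
    qed
  qed
  then show "coeff (p * q) (m + n) = coeff p m * coeff q n" by simp
qed

lemma degree_le_prod_coeff_prod:
  fixes f :: "'i \<Rightarrow> 'f::comm_semiring_1 poly"
  assumes "finite I" "\<And>i. i \<in> I \<Longrightarrow> degree (f i) \<le> d i"
  shows "degree (prod f I) \<le> sum d I \<and> coeff (prod f I) (sum d I) = (\<Prod>i\<in>I. coeff (f i) (d i))"
  using assms
proof (induction I rule: finite_induct)
  case (insert j I)
  then show ?case
    using degree_le_mult_coeff_mult[of "f j" "d j" "prod f I" "sum d I"] by auto
qed auto

lemma degree_le_power_coeff_power:
  fixes p :: "'f::comm_semiring_1 poly"
  assumes "degree p \<le> d"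
  shows "degree (p ^ n) \<le> d * n \<and> coeff (p ^ n) (d * n) = coeff p d ^ n"
  using degree_le_prod_coeff_prod[of "{..<n}" "\<lambda>_. p" "\<lambda>_. d"] assms by (simp add: mult.commute)

subsection \<open>Hasse derivatives and orders of vanishing\<close>

text \<open>Exponents outside \<open>I\<close> are pinned to 0, so that every monomial in the
  variables \<open>I\<close> has exactly one representative.\<close>

definition exps :: "'i set \<Rightarrow> nat \<Rightarrow> ('i \<Rightarrow> nat) set" where
  "exps I D = {\<alpha>. (\<forall>i. i \<notin> I \<longrightarrow> \<alpha> i = 0) \<and> sum \<alpha> I \<le> D}"

lemma exps_insert:
  assumes "finite I" "j \<notin> I"
  shows "exps (insert j I) D = (\<Union>k\<le>D. (\<lambda>\<alpha>. \<alpha>(j := k)) ` exps I (D - k))"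
proof (intro equalityI subsetI)
  fix \<alpha> assume \<alpha>: "\<alpha> \<in> exps (insert j I) D"
  have eq: "sum (\<alpha>(j := 0)) I = sum \<alpha> I"
    by (rule sum.cong) (use assms in auto)
  have "\<alpha>(j := 0) \<in> exps I (D - \<alpha> j)" "\<alpha> j \<le> D"
    using \<alpha> assms by (auto simp: exps_def eq simp del: fun_upd_apply) (auto simp: fun_upd_def)
  moreover have "\<alpha> = (\<alpha>(j := 0))(j := \<alpha> j)" by simp
  ultimately show "\<alpha> \<in> (\<Union>k\<le>D. (\<lambda>\<alpha>. \<alpha>(j := k)) ` exps I (D - k))"
    by blast
next
  fix \<alpha> assume "\<alpha> \<in> (\<Union>k\<le>D. (\<lambda>\<alpha>. \<alpha>(j := k)) ` exps I (D - k))"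
  then obtain k \<beta> where k: "k \<le> D" "\<beta> \<in> exps I (D - k)" "\<alpha> = \<beta>(j := k)" by auto
  have "sum (\<beta>(j := k)) I = sum \<beta> I"
    by (rule sum.cong) (use assms in auto)
  with k assms show "\<alpha> \<in> exps (insert j I) D"
    by (auto simp: exps_def)
qed

lemma finite_exps: "finite I \<Longrightarrow> finite (exps I D)"
proof (induction I arbitrary: D rule: finite_induct)
  case empty
  have "exps {} D = {\<lambda>_::'a. 0}" by (auto simp: exps_def)
  then show ?case by simp
qed (auto simp: exps_insert)

text \<open>Slicing by the exponent of \<open>j\<close> turns the count into a hockey-stick sum of
  binomial coefficients.\<close>

lemma card_exps: "finite I \<Longrightarrow> card (exps I D) = (D + card I) choose card I"
proof (induction I arbitrary: D rule: finite_induct)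
  case empty
  have "exps {} D = {\<lambda>_::'a. 0}" by (auto simp: exps_def)
  then show ?case by simp
next
  case (insert j I)
  have "card (exps (insert j I) D) = (\<Sum>k\<le>D. card ((\<lambda>\<alpha>. \<alpha>(j := k)) ` exps I (D - k)))"
    unfolding exps_insert[OF insert.hyps]
  proof (rule card_UN_disjoint)
    show "\<forall>i\<in>{..D}. \<forall>k\<in>{..D}. i \<noteq> k \<longrightarrow>
        (\<lambda>\<alpha>. \<alpha>(j := i)) ` exps I (D - i) \<inter> (\<lambda>\<alpha>. \<alpha>(j := k)) ` exps I (D - k) = {}"
      by (auto dest: fun_cong[of _ _ j])
  qed (use insert.hyps finite_exps in auto)
  also have "\<dots> = (\<Sum>k\<le>D. (D - k + card I) choose card I)"
  proof (rule sum.cong[OF refl])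
    fix k
    have "inj_on (\<lambda>\<alpha>. \<alpha>(j := k)) (exps I (D - k))"
    proof (rule inj_onI, rule ext)
      fix \<alpha> \<beta> :: "'a \<Rightarrow> nat" and i
      assume "\<alpha> \<in> exps I (D - k)" "\<beta> \<in> exps I (D - k)" "\<alpha>(j := k) = \<beta>(j := k)"
      then show "\<alpha> i = \<beta> i"
        using insert.hyps(2) by (cases "i = j") (auto simp: exps_def dest: fun_cong[of _ _ i])
    qed
    then show "card ((\<lambda>\<alpha>. \<alpha>(j := k)) ` exps I (D - k)) = (D - k + card I) choose card I"
      by (simp add: card_image insert.IH)
  qed
  also have "\<dots> = (\<Sum>k\<le>D. (card I + k) choose card I)"
    by (rule sum.reindex_bij_witness[of _ "\<lambda>k. D - k" "\<lambda>k. D - k"]) (auto simp: add.commute)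
  also have "\<dots> = (card I + D + 1) choose (card I + 1)"
    by (rule choose_rising_sum)
  finally show ?case using insert.hyps by (simp add: add.commute)
qed

text \<open>\<open>hmon I \<alpha> \<beta>\<close> is the Hasse derivative of order \<open>\<beta>\<close> of the monomial with exponents \<open>\<alpha>\<close>; where
  \<open>\<alpha> i - \<beta> i\<close> is truncated, the binomial coefficient is zero. A polynomial of degree at most \<open>D\<close> in
  the variables \<open>I\<close> is a coefficient function restricted to \<open>exps I D\<close>.\<close>

definition hmon :: "'i set \<Rightarrow> ('i \<Rightarrow> nat) \<Rightarrow> ('i \<Rightarrow> nat) \<Rightarrow> ('i \<Rightarrow> 'r) \<Rightarrow> 'r::comm_semiring_1" where
  "hmon I \<alpha> \<beta> x = (\<Prod>i\<in>I. of_nat (\<alpha> i choose \<beta> i) * x i ^ (\<alpha> i - \<beta> i))"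

definition hderiv ::
  "'i set \<Rightarrow> nat \<Rightarrow> (('i \<Rightarrow> nat) \<Rightarrow> 'r) \<Rightarrow> ('i \<Rightarrow> nat) \<Rightarrow> ('i \<Rightarrow> 'r) \<Rightarrow> 'r::comm_semiring_1" where
  "hderiv I D c \<beta> x = (\<Sum>\<alpha>\<in>exps I D. c \<alpha> * hmon I \<alpha> \<beta> x)"

text \<open>Iterated formal derivatives carry factorials that may be zero in positive
  characteristic; Hasse derivatives are Taylor coefficients over every commutative ring. Values of
  \<open>\<beta>\<close> outside \<open>I\<close> have no influence on
  \<open>hderiv\<close>.\<close>

definition vanishes ::
  "'i set \<Rightarrow> nat \<Rightarrow> (('i \<Rightarrow> nat) \<Rightarrow> 'r) \<Rightarrow> nat \<Rightarrow> ('i \<Rightarrow> 'r::comm_semiring_1) \<Rightarrow> bool" where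
  "vanishes I D c M x \<longleftrightarrow> (\<forall>\<beta>. sum \<beta> I < M \<longrightarrow> hderiv I D c \<beta> x = 0)"

lemma hmon_cong:
  assumes "\<And>i. i \<in> I \<Longrightarrow> \<alpha> i = \<alpha>' i" "\<And>i. i \<in> I \<Longrightarrow> \<beta> i = \<beta>' i" "\<And>i. i \<in> I \<Longrightarrow> x i = y i"
  shows "hmon I \<alpha> \<beta> x = hmon I \<alpha>' \<beta>' y"
  unfolding hmon_def by (rule prod.cong) (use assms in auto)

lemma hmon_insert:
  assumes "finite I" "j \<notin> I"
  shows "hmon (insert j I) \<alpha> \<beta> x = of_nat (\<alpha> j choose \<beta> j) * x j ^ (\<alpha> j - \<beta> j) * hmon I \<alpha> \<beta> x"
  using assms by (simp add: hmon_def)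

lemma hmon_const_poly: "hmon I \<alpha> \<beta> (\<lambda>i. [:x i:]) = [:hmon I \<alpha> \<beta> x :: 'f::comm_ring_1:]"
  by (induction I rule: infinite_finite_induct)
    (auto simp: hmon_def poly_const_pow of_nat_poly one_pCons)

lemma hmon_eq_0:
  assumes "finite I" "i \<in> I" "\<alpha> i < \<beta> i"
  shows "hmon I \<alpha> \<beta> x = 0"
  unfolding hmon_def using assms by (metis (mono_tags, lifting) binomial_eq_0 mult_zero_left of_nat_0 prod_zero)

lemma hderiv_cong:
  assumes "\<And>i. i \<in> I \<Longrightarrow> \<beta> i = \<beta>' i" "\<And>i. i \<in> I \<Longrightarrow> x i = y i"
  shows "hderiv I D c \<beta> x = hderiv I D c \<beta>' y"
  unfolding hderiv_def by (intro sum.cong refl arg_cong2[where f = "(*)"] hmon_cong) (use assms in auto)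

lemma vanishes_cong:
  assumes "\<And>i. i \<in> I \<Longrightarrow> x i = y i"
  shows "vanishes I D c M x = vanishes I D c M y"
  unfolding vanishes_def using hderiv_cong[of I _ _ x y] assms by metis

section \<open>Taylor expansion of Hasse derivatives and composition with curves\<close>

text \<open>Expand \<open>((x - a) + a) ^ (n - b)\<close> and regroup the binomial coefficients with
  \<open>choose_mult\<close>. The terms up to the uniform bound \<open>D\<close> are zero beyond
  \<open>n - b\<close>; a range independent of \<open>n\<close> allows multiplying over variables
  and summing over monomials.\<close>

lemma binomial_power_taylor:
  fixes x a :: "'r::comm_ring_1"
  assumes "n \<le> D"
  shows "of_nat (n choose b) * x ^ (n - b) =
    (\<Sum>k\<le>D. of_nat ((b + k) choose b) * (x - a) ^ k * (of_nat (n choose (b + k)) * a ^ (n - (b + k))))"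
proof (cases "b \<le> n")
  case True
  have "x ^ (n - b) = ((x - a) + a) ^ (n - b)" by simp
  also have "\<dots> = (\<Sum>k\<le>n - b. of_nat ((n - b) choose k) * (x - a) ^ k * a ^ (n - b - k))"
    by (rule binomial_ring)
  finally have "of_nat (n choose b) * x ^ (n - b) =
      (\<Sum>k\<le>n - b. of_nat (n choose b) * (of_nat ((n - b) choose k) * (x - a) ^ k * a ^ (n - b - k)))"
    by (simp add: sum_distrib_left)
  also have "\<dots> = (\<Sum>k\<le>n - b. of_nat ((b + k) choose b) * (x - a) ^ k *
      (of_nat (n choose (b + k)) * a ^ (n - (b + k))))"
  proof (rule sum.cong[OF refl])
    fix k assume "k \<in> {..n - b}"
    then have "(n choose (b + k)) * ((b + k) choose b) = (n choose b) * ((n - b) choose (b + k - b))"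
      using True by (intro choose_mult) auto
    then have "of_nat (n choose b) * of_nat ((n - b) choose k) =
        (of_nat (n choose (b + k)) * of_nat ((b + k) choose b) :: 'r)"
      by (metis add_diff_cancel_left' of_nat_mult)
    then have "(of_nat (n choose b) * of_nat ((n - b) choose k)) * ((x - a) ^ k * a ^ (n - b - k)) =
        (of_nat (n choose (b + k)) * of_nat ((b + k) choose b)) * ((x - a) ^ k * a ^ (n - b - k))"
      by (rule arg_cong)
    then show "of_nat (n choose b) * (of_nat ((n - b) choose k) * (x - a) ^ k * a ^ (n - b - k)) =
        of_nat ((b + k) choose b) * (x - a) ^ k * (of_nat (n choose (b + k)) * a ^ (n - (b + k)))"
      by (simp add: mult_ac)
  qed
  also have "\<dots> = (\<Sum>k\<le>D. of_nat ((b + k) choose b) * (x - a) ^ k *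
      (of_nat (n choose (b + k)) * a ^ (n - (b + k))))"
  proof (rule sum.mono_neutral_left)
    show "\<forall>i\<in>{..D} - {..n - b}. of_nat ((b + i) choose b) * (x - a) ^ i *
        (of_nat (n choose (b + i)) * a ^ (n - (b + i))) = 0"
    proof
      fix i assume "i \<in> {..D} - {..n - b}"
      then have "n < b + i" by auto
      then show "of_nat ((b + i) choose b) * (x - a) ^ i *
          (of_nat (n choose (b + i)) * a ^ (n - (b + i))) = 0"
        by (simp add: binomial_eq_0)
    qed
  qed (use assms in auto)
  finally show ?thesis .
qed (simp add: binomial_eq_0)

lemma hmon_taylor:
  fixes x a :: "'i \<Rightarrow> 'r::comm_ring_1"
  assumes "finite I" "\<alpha> \<in> exps I D"
  shows "hmon I \<alpha> \<beta> x = (\<Sum>\<gamma>\<in>PiE I (\<lambda>_. {..D}).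
    (\<Prod>i\<in>I. of_nat ((\<beta> i + \<gamma> i) choose \<beta> i) * (x i - a i) ^ \<gamma> i) * hmon I \<alpha> (\<lambda>i. \<beta> i + \<gamma> i) a)"
proof -
  have le: "\<alpha> i \<le> D" if "i \<in> I" for i
    using assms that member_le_sum[of i I \<alpha>] by (auto simp: exps_def)
  have "hmon I \<alpha> \<beta> x = (\<Prod>i\<in>I. \<Sum>k\<le>D. of_nat ((\<beta> i + k) choose \<beta> i) * (x i - a i) ^ k *
      (of_nat (\<alpha> i choose (\<beta> i + k)) * a i ^ (\<alpha> i - (\<beta> i + k))))"
    unfolding hmon_def by (intro prod.cong refl binomial_power_taylor le)
  also have "\<dots> = (\<Sum>\<gamma>\<in>PiE I (\<lambda>_. {..D}). \<Prod>i\<in>I. of_nat ((\<beta> i + \<gamma> i) choose \<beta> i) * (x i - a i) ^ \<gamma> i *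
      (of_nat (\<alpha> i choose (\<beta> i + \<gamma> i)) * a i ^ (\<alpha> i - (\<beta> i + \<gamma> i))))"
    using assms by (intro prod_sum_PiE) auto
  also have "\<dots> = (\<Sum>\<gamma>\<in>PiE I (\<lambda>_. {..D}).
    (\<Prod>i\<in>I. of_nat ((\<beta> i + \<gamma> i) choose \<beta> i) * (x i - a i) ^ \<gamma> i) * hmon I \<alpha> (\<lambda>i. \<beta> i + \<gamma> i) a)"
    by (simp add: hmon_def prod.distrib)
  finally show ?thesis .
qed

lemma hderiv_taylor:
  fixes x a :: "'i \<Rightarrow> 'r::comm_ring_1"
  assumes "finite I"
  shows "hderiv I D c \<beta> x = (\<Sum>\<gamma>\<in>PiE I (\<lambda>_. {..D}).
    (\<Prod>i\<in>I. of_nat ((\<beta> i + \<gamma> i) choose \<beta> i) * (x i - a i) ^ \<gamma> i) * hderiv I D c (\<lambda>i. \<beta> i + \<gamma> i) a)"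
  unfolding hderiv_def sum_distrib_left
  by (subst sum.swap, intro sum.cong refl)
    (simp add: hmon_taylor[OF assms, of _ D \<beta> x a] sum_distrib_left mult_ac)

text \<open>Expand around the constant polynomials \<open>[:poly (p i) t:]\<close>. A term either
  contains a derivative of order below \<open>M\<close>, which is zero, or has
  \<open>sum \<gamma> I \<ge> M - sum \<beta> I\<close> factors
  \<open>p i - [:poly (p i) t:]\<close>, each divisible by \<open>[:- t, 1:]\<close>.\<close>

lemma power_dvd_hderiv_curve:
  fixes p :: "'i \<Rightarrow> 'f::field poly"
  assumes "finite I" "vanishes I D c M (\<lambda>i. poly (p i) t)"
  shows "[:- t, 1:] ^ (M - sum \<beta> I) dvd hderiv I D (\<lambda>\<alpha>. [:c \<alpha>:]) \<beta> p"
  unfolding hderiv_taylor[OF assms(1), of D "\<lambda>\<alpha>. [:c \<alpha>:]" \<beta> p "\<lambda>i. [:poly (p i) t:]"]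
proof (rule dvd_sum)
  fix \<gamma>
  show "[:- t, 1:] ^ (M - sum \<beta> I) dvd
    (\<Prod>i\<in>I. of_nat ((\<beta> i + \<gamma> i) choose \<beta> i) * (p i - [:poly (p i) t:]) ^ \<gamma> i) *
      hderiv I D (\<lambda>\<alpha>. [:c \<alpha>:]) (\<lambda>i. \<beta> i + \<gamma> i) (\<lambda>i. [:poly (p i) t:])"
  proof (cases "sum \<beta> I + sum \<gamma> I < M")
    case True
    have "hderiv I D (\<lambda>\<alpha>. [:c \<alpha>:]) (\<lambda>i. \<beta> i + \<gamma> i) (\<lambda>i. [:poly (p i) t:]) =
        [:hderiv I D c (\<lambda>i. \<beta> i + \<gamma> i) (\<lambda>i. poly (p i) t):]"
      unfolding hderiv_def hmon_const_poly by (simp add: sum_to_poly mult.commute)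
    also have "hderiv I D c (\<lambda>i. \<beta> i + \<gamma> i) (\<lambda>i. poly (p i) t) = 0"
      using assms(2) True by (simp add: vanishes_def sum.distrib)
    finally show ?thesis by simp
  next
    case False
    have "[:- t, 1:] ^ (M - sum \<beta> I) dvd [:- t, 1:] ^ sum \<gamma> I"
      using False by (intro le_imp_power_dvd) auto
    also have "[:- t, 1:] ^ sum \<gamma> I = (\<Prod>i\<in>I. [:- t, 1:] ^ \<gamma> i)"
      by (simp add: power_sum)
    also have "\<dots> dvd (\<Prod>i\<in>I. of_nat ((\<beta> i + \<gamma> i) choose \<beta> i) * (p i - [:poly (p i) t:]) ^ \<gamma> i)"
      by (intro prod_dvd_prod dvd_mult dvd_power_same) (simp flip: poly_eq_0_iff_dvd)
    finally show ?thesis by (rule dvd_mult2)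
  qed
qed

lemma hderiv_curve_eq_0:
  fixes p :: "'i \<Rightarrow> 'f::field poly"
  assumes "finite I" "finite T" "\<And>t. t \<in> T \<Longrightarrow> vanishes I D c M (\<lambda>i. poly (p i) t)"
    and "degree (hderiv I D (\<lambda>\<alpha>. [:c \<alpha>:]) \<beta> p) < (M - sum \<beta> I) * card T"
  shows "hderiv I D (\<lambda>\<alpha>. [:c \<alpha>:]) \<beta> p = 0"
  using assms by (intro poly_eq_0_if_power_dvd[of T "M - sum \<beta> I"] power_dvd_hderiv_curve)

text \<open>Along a curve, the formal top coefficient of a derivative is the same derivative at the
  vector of top coefficients of the curve. Truncated subtraction is harmless: if some
  \<open>\<alpha> i < \<beta> i\<close>, both sides are zero.\<close>

lemma degree_hmon_le_coeff_hmon: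
  fixes p :: "'i \<Rightarrow> 'f::comm_ring_1 poly"
  assumes "finite I" "\<And>i. i \<in> I \<Longrightarrow> degree (p i) \<le> e"
  shows "degree (hmon I \<alpha> \<beta> p) \<le> e * (sum \<alpha> I - sum \<beta> I) \<and>
    coeff (hmon I \<alpha> \<beta> p) (e * (sum \<alpha> I - sum \<beta> I)) = hmon I \<alpha> \<beta> (\<lambda>i. coeff (p i) e)"
proof (cases "\<exists>i\<in>I. \<alpha> i < \<beta> i")
  case True
  then obtain i where i: "i \<in> I" "\<alpha> i < \<beta> i" by auto
  show ?thesis by (simp add: hmon_eq_0[where i = i] assms(1) i)
next
  case False
  then have le: "\<beta> i \<le> \<alpha> i" if "i \<in> I" for i
    using that by (simp add: not_less)
  have sum_eq: "(\<Sum>i\<in>I. e * (\<alpha> i - \<beta> i)) = e * (sum \<alpha> I - sum \<beta> I)"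
    using sum_subtractf_nat[of I \<beta> \<alpha>] le by (simp flip: sum_distrib_left)
  have fac: "degree (of_nat (\<alpha> i choose \<beta> i) * p i ^ (\<alpha> i - \<beta> i)) \<le> e * (\<alpha> i - \<beta> i) \<and>
      coeff (of_nat (\<alpha> i choose \<beta> i) * p i ^ (\<alpha> i - \<beta> i)) (e * (\<alpha> i - \<beta> i)) =
      of_nat (\<alpha> i choose \<beta> i) * coeff (p i) e ^ (\<alpha> i - \<beta> i)" if "i \<in> I" for i
    using degree_le_mult_coeff_mult[of "of_nat (\<alpha> i choose \<beta> i)" 0 "p i ^ (\<alpha> i - \<beta> i)" "e * (\<alpha> i - \<beta> i)"]
      degree_le_power_coeff_power[OF assms(2)[OF that], of "\<alpha> i - \<beta> i"]
    by (simp add: of_nat_poly)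
  have "degree (hmon I \<alpha> \<beta> p) \<le> (\<Sum>i\<in>I. e * (\<alpha> i - \<beta> i)) \<and>
      coeff (hmon I \<alpha> \<beta> p) (\<Sum>i\<in>I. e * (\<alpha> i - \<beta> i)) =
      (\<Prod>i\<in>I. coeff (of_nat (\<alpha> i choose \<beta> i) * p i ^ (\<alpha> i - \<beta> i)) (e * (\<alpha> i - \<beta> i)))"
    unfolding hmon_def using fac by (intro degree_le_prod_coeff_prod assms(1)) blast
  moreover have "(\<Prod>i\<in>I. coeff (of_nat (\<alpha> i choose \<beta> i) * p i ^ (\<alpha> i - \<beta> i)) (e * (\<alpha> i - \<beta> i))) =
      hmon I \<alpha> \<beta> (\<lambda>i. coeff (p i) e)"
    unfolding hmon_def using fac by (intro prod.cong refl) blast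
  ultimately show ?thesis unfolding sum_eq by simp
qed

text \<open>If \<open>k\<close> is the degree in \<open>x_j\<close>, then the coefficient of \<open>x_j^k\<close>, a polynomial in the other
  variables, vanishes to order \<open>M - k div |S|\<close> on the smaller grid: its derivatives of lower order are
  leading coefficients of univariate polynomials of degree \<open>k\<close> with more than \<open>k\<close> zeros.\<close>

lemma vanishing_on_grid:
  fixes S :: "'f::field set"
  assumes "finite I" "finite S" "D < M * card S"
    and "\<And>a. (\<forall>i\<in>I. a i \<in> S) \<Longrightarrow> vanishes I D c M a"
    and "\<alpha> \<in> exps I D"
  shows "c \<alpha> = 0"
  using assms(1,3-)
proof (induction I arbitrary: D M c \<alpha> rule: finite_induct)
  case empty
  have e: "exps {} D = {\<lambda>_::'a. 0}" by (auto simp: exps_def)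
  have "M > 0" using empty.prems(1) by (cases M) auto
  then have "hderiv {} D c (\<lambda>_. 0) (\<lambda>_. 0) = 0"
    using empty.prems(2)[of "\<lambda>_. 0"] by (auto simp: vanishes_def)
  then show ?case using empty.prems(3) e by (simp add: hderiv_def e hmon_def)
next
  case (insert j I)
  show ?case
  proof (rule ccontr)
    assume "c \<alpha> \<noteq> 0"
    define k where "k = Max ((\<lambda>\<alpha>. \<alpha> j) ` {\<alpha>\<in>exps (insert j I) D. c \<alpha> \<noteq> 0})"
    have fin: "finite {\<alpha>\<in>exps (insert j I) D. c \<alpha> \<noteq> 0}"
      using insert.hyps(1) by (simp add: finite_exps)
    have "k \<in> (\<lambda>\<alpha>. \<alpha> j) ` {\<alpha>\<in>exps (insert j I) D. c \<alpha> \<noteq> 0}"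
      unfolding k_def by (rule Max_in) (use fin \<open>c \<alpha> \<noteq> 0\<close> insert.prems(3) in auto)
    then obtain \<alpha>0 where \<alpha>0: "\<alpha>0 \<in> exps (insert j I) D" "c \<alpha>0 \<noteq> 0" "\<alpha>0 j = k"
      by auto
    have max: "\<alpha> j \<le> k" if "\<alpha> \<in> exps (insert j I) D" "c \<alpha> \<noteq> 0" for \<alpha>
      unfolding k_def using fin that by (intro Max_ge) auto
    define c' where "c' = (\<lambda>\<alpha>. c (\<alpha>(j := k)))"
    define s where "s = card S"
    have "s > 0" using insert.prems(1) by (cases "s = 0") (auto simp: s_def)
    have "k \<le> D"
      using \<alpha>0 insert.hyps by (auto simp: exps_def)
    have "vanishes I (D - k) c' (M - k div s) a" if a: "\<forall>i\<in>I. a i \<in> S" for a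
      unfolding vanishes_def
    proof (intro allI impI)
      fix \<beta> :: "'a \<Rightarrow> nat" assume \<beta>: "sum \<beta> I < M - k div s"
      \<comment> \<open>The curve is the line through \<open>a\<close> parallel to the axis of
        \<open>j\<close>. Since \<open>\<beta>'\<close> does not differentiate in that direction,
        exponents of \<open>j\<close> become exponents of the parameter.\<close>
      define p where "p = (\<lambda>i. [:a i:])(j := [:0, 1:])"
      define \<beta>' where "\<beta>' = \<beta>(j := 0)"
      have \<beta>': "sum \<beta>' (insert j I) = sum \<beta> I"
        using insert.hyps by (auto simp: \<beta>'_def intro!: sum.cong)
      define R where "R = hderiv (insert j I) D (\<lambda>\<alpha>. [:c \<alpha>:]) \<beta>' p"
      have hp: "hmon (insert j I) \<alpha> \<beta>' p = monom (hmon I \<alpha> \<beta> a) (\<alpha> j)" for \<alpha>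
      proof -
        have "hmon I \<alpha> \<beta>' p = hmon I \<alpha> \<beta> (\<lambda>i. [:a i:])"
          using insert.hyps by (intro hmon_cong) (auto simp: \<beta>'_def p_def)
        then show ?thesis
          using insert.hyps by (simp add: hmon_insert \<beta>'_def p_def hmon_const_poly monom_altdef)
      qed
      have R: "R = (\<Sum>\<alpha>\<in>exps (insert j I) D. monom (c \<alpha> * hmon I \<alpha> \<beta> a) (\<alpha> j))"
        unfolding R_def hderiv_def hp by (simp add: smult_monom)
      have "degree R \<le> k"
        unfolding R
      proof (rule degree_sum_le)
        fix \<alpha> assume "\<alpha> \<in> exps (insert j I) D"
        then show "degree (monom (c \<alpha> * hmon I \<alpha> \<beta> a) (\<alpha> j)) \<le> k"
          using max[of \<alpha>] degree_monom_le[of "c \<alpha> * hmon I \<alpha> \<beta> a" "\<alpha> j"]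
          by (cases "c \<alpha> = 0") auto
      next
        show "finite (exps (insert j I) D)" using insert.hyps(1) by (intro finite_exps) auto
      qed
      also have "k < (M - sum \<beta> I) * s"
      proof -
        \<comment> \<open>The order of \<open>\<beta>\<close> leaves multiplicity at least
          \<open>k div s + 1\<close> at each of the \<open>s\<close> points, just enough to exceed
          \<open>k\<close>.\<close>
        have "k < Suc (k div s) * s"
          using \<open>s > 0\<close> dividend_less_div_times[of s k] by simp
        also have "\<dots> \<le> (M - sum \<beta> I) * s"
          using \<beta> by (intro mult_le_mono) auto
        finally show ?thesis .
      qed
      finally have deg: "degree R < (M - sum \<beta>' (insert j I)) * card S"
        unfolding s_def \<beta>' .
      have "vanishes (insert j I) D c M (\<lambda>i. poly (p i) t)" if "t \<in> S" for t
        by (rule insert.prems(2)) (use that a in \<open>simp add: p_def\<close>)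
      with deg have "R = 0"
        unfolding R_def using insert.hyps(1) assms(2) by (intro hderiv_curve_eq_0) auto
      then have "0 = coeff R k" by simp
      also have "\<dots> = (\<Sum>\<alpha>\<in>exps (insert j I) D. if \<alpha> j = k then c \<alpha> * hmon I \<alpha> \<beta> a else 0)"
        unfolding R coeff_sum by (intro sum.cong) auto
      also have "\<dots> = (\<Sum>\<alpha>\<in>{\<alpha>\<in>exps (insert j I) D. \<alpha> j = k}. c \<alpha> * hmon I \<alpha> \<beta> a)"
        using insert.hyps by (intro sum.inter_filter[symmetric] finite_exps) auto
      also have "\<dots> = (\<Sum>\<alpha>\<in>exps I (D - k). c' \<alpha> * hmon I \<alpha> \<beta> a)"
      \<comment> \<open>Erasing and restoring the exponent \<open>k\<close> of \<open>j\<close> are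
        mutually inverse.\<close>
      proof (rule sum.reindex_bij_witness[of _ "\<lambda>\<alpha>. \<alpha>(j := k)" "\<lambda>\<alpha>. \<alpha>(j := 0)"])
        fix \<alpha> assume "\<alpha> \<in> {\<alpha> \<in> exps (insert j I) D. \<alpha> j = k}"
        moreover have "sum (\<alpha>(j := 0)) I = sum \<alpha> I"
          by (rule sum.cong) (use insert.hyps in auto)
        ultimately show "\<alpha>(j := 0) \<in> exps I (D - k)"
          using insert.hyps by (auto simp: exps_def simp del: fun_upd_apply) (auto simp: fun_upd_def)
        show "c' (\<alpha>(j := 0)) * hmon I (\<alpha>(j := 0)) \<beta> a = c \<alpha> * hmon I \<alpha> \<beta> a"
        proof -
          have "hmon I (\<alpha>(j := 0)) \<beta> a = hmon I \<alpha> \<beta> a"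
            using insert.hyps by (intro hmon_cong) auto
          moreover have "(\<alpha>(j := 0))(j := k) = \<alpha>"
            using \<open>\<alpha> \<in> _\<close> by auto
          ultimately show ?thesis by (simp add: c'_def)
        qed
      next
        fix \<alpha> assume \<alpha>: "\<alpha> \<in> exps I (D - k)"
        then have "\<alpha> j = 0" using insert.hyps by (auto simp: exps_def)
        then show "(\<alpha>(j := k))(j := 0) = \<alpha>" by auto
        show "\<alpha>(j := k) \<in> {\<alpha> \<in> exps (insert j I) D. \<alpha> j = k}"
          using \<alpha> \<open>k \<le> D\<close> insert.hyps by (subst exps_insert) auto
      next
        fix \<alpha> assume "\<alpha> \<in> {\<alpha> \<in> exps (insert j I) D. \<alpha> j = k}"
        then show "(\<alpha>(j := 0))(j := k) = \<alpha>" by (simp add: fun_upd_idem)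
      qed
      finally show "hderiv I (D - k) c' \<beta> a = 0" by (simp add: hderiv_def)
    qed
    moreover have "D - k < (M - k div s) * s"
    proof -
      have "D < M * s" using insert.prems(1) by (simp add: s_def)
      moreover have "k div s * s \<le> k" by simp
      moreover have "D - k < M * s - u" if "D < M * s" "u \<le> k" for u
        using that \<open>k \<le> D\<close> by linarith
      ultimately show ?thesis
        unfolding diff_mult_distrib by blast
    qed
    moreover have "\<alpha>0(j := 0) \<in> exps I (D - k)"
    proof -
      have "sum (\<alpha>0(j := 0)) I = sum \<alpha>0 I"
        by (rule sum.cong) (use insert.hyps in auto)
      then show ?thesis
        using \<alpha>0 insert.hyps by (auto simp: exps_def simp del: fun_upd_apply) (auto simp: fun_upd_def)
    qed
    ultimately have "c' (\<alpha>0(j := 0)) = 0"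
      unfolding s_def by (intro insert.IH)
    then show False using \<alpha>0 by (auto simp: c'_def)
  qed
qed

subsection \<open>The counting inequality\<close>

text \<open>Finite field theory enters only through \<open>curves\<close>, with \<open>e\<close> in
  the role of \<open>q ^ (r - 1)\<close>; the choice of degree and multiplicities enters only
  through the last two hypotheses.\<close>

lemma card_exps_le_of_curves:
  fixes S :: "'f::field set" and K :: "('i \<Rightarrow> 'f) set"
  assumes "finite I" "finite S" "finite K" "e \<ge> 1" "card S = q * e"
    and curves: "\<And>s. (\<forall>i\<in>I. s i \<in> S) \<Longrightarrow> \<exists>p :: 'i \<Rightarrow> 'f poly.
      (\<forall>i\<in>I. degree (p i) \<le> e \<and> coeff (p i) e = s i) \<and>
      (\<forall>t\<in>S. \<exists>x\<in>K. \<forall>i\<in>I. x i = poly (p i) t)"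
    and "D < M * card S"
    and mult: "\<And>w. w < M \<Longrightarrow> w \<le> D \<Longrightarrow> D - w < (m - w) * q"
  shows "card (exps I D) \<le> card K * card (exps I (m - 1))"
proof (rule ccontr)
  assume "\<not> card (exps I D) \<le> card K * card (exps I (m - 1))"
  then have less: "card (K \<times> exps I (m - 1)) < card (exps I D)"
    by (simp add: card_cartesian_product)
  have fin: "finite (exps I k)" for k
    using assms(1) by (rule finite_exps)
  \<comment> \<open>The unknowns are the coefficients; there is one linear condition for each point
    of \<open>K\<close> and each derivative of order below \<open>m\<close>.\<close>
  obtain c where c: "\<exists>\<alpha>\<in>exps I D. c \<alpha> \<noteq> 0"
      "\<And>x \<beta>. x \<in> K \<Longrightarrow> \<beta> \<in> exps I (m - 1) \<Longrightarrow> hderiv I D c \<beta> x = 0"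
    using exists_nontrivial_solution[OF _ fin less, of "\<lambda>(x, \<beta>) \<alpha>. hmon I \<alpha> \<beta> x"] assms(3) fin
    by (auto simp: hderiv_def)
  have van: "vanishes I D c m x" if "x \<in> K" for x
    unfolding vanishes_def
  proof (intro allI impI)
    fix \<beta> :: "'i \<Rightarrow> nat" assume "sum \<beta> I < m"
    moreover define \<beta>' where "\<beta>' = (\<lambda>i. if i \<in> I then \<beta> i else 0)"
    moreover have "sum \<beta>' I = sum \<beta> I" by (rule sum.cong) (auto simp: \<beta>'_def)
    ultimately have "\<beta>' \<in> exps I (m - 1)" by (auto simp: exps_def)
    with that have "hderiv I D c \<beta>' x = 0" by (rule c(2))
    also have "hderiv I D c \<beta>' x = hderiv I D c \<beta> x"
      by (rule hderiv_cong) (auto simp: \<beta>'_def)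
    finally show "hderiv I D c \<beta> x = 0" .
  qed
  define D' where "D' = Max ((\<lambda>\<alpha>. sum \<alpha> I) ` {\<alpha>\<in>exps I D. c \<alpha> \<noteq> 0})"
  have "D' \<in> (\<lambda>\<alpha>. sum \<alpha> I) ` {\<alpha>\<in>exps I D. c \<alpha> \<noteq> 0}"
    unfolding D'_def by (rule Max_in) (use fin c(1) in auto)
  then obtain \<alpha>0 where \<alpha>0: "\<alpha>0 \<in> exps I D" "c \<alpha>0 \<noteq> 0" "sum \<alpha>0 I = D'"
    by auto
  have "D' \<le> D" using \<alpha>0 by (auto simp: exps_def)
  have max: "sum \<alpha> I \<le> D'" if "\<alpha> \<in> exps I D" "c \<alpha> \<noteq> 0" for \<alpha>
    unfolding D'_def using fin that by (intro Max_ge) auto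
  \<comment> \<open>The top homogeneous part, at the true degree \<open>D'\<close>, which may be
    smaller than \<open>D\<close>.\<close>
  define lead where "lead = (\<lambda>\<alpha>. if sum \<alpha> I = D' then c \<alpha> else 0)"
  have "vanishes I D lead M s" if s: "\<forall>i\<in>I. s i \<in> S" for s
    unfolding vanishes_def
  proof (intro allI impI)
    fix \<beta> :: "'i \<Rightarrow> nat" assume \<beta>: "sum \<beta> I < M"
    show "hderiv I D lead \<beta> s = 0"
    proof (cases "sum \<beta> I \<le> D'")
      case False
      have "lead \<alpha> * hmon I \<alpha> \<beta> s = 0" for \<alpha>
      proof (cases "sum \<alpha> I = D'")
        case True
        with False have "\<not> sum \<beta> I \<le> sum \<alpha> I" by simp
        then have "\<not> (\<forall>i\<in>I. \<beta> i \<le> \<alpha> i)" using sum_mono[of I \<beta> \<alpha>] by blast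
        then obtain i where "i \<in> I" "\<alpha> i < \<beta> i" by (auto simp: not_le)
        then show ?thesis by (simp add: hmon_eq_0[where i = i] assms(1))
      qed (simp add: lead_def)
      then show ?thesis unfolding hderiv_def by (intro sum.neutral) blast
    next
      case True
      define w where "w = sum \<beta> I"
      obtain p where p: "\<And>i. i \<in> I \<Longrightarrow> degree (p i) \<le> e" "\<And>i. i \<in> I \<Longrightarrow> coeff (p i) e = s i"
          "\<And>t. t \<in> S \<Longrightarrow> \<exists>x\<in>K. \<forall>i\<in>I. x i = poly (p i) t"
        using curves[OF s] by blast
      define R where "R = hderiv I D (\<lambda>\<alpha>. [:c \<alpha>:]) \<beta> p"
      have hp: "degree (hmon I \<alpha> \<beta> p) \<le> e * (sum \<alpha> I - w)"
          "coeff (hmon I \<alpha> \<beta> p) (e * (sum \<alpha> I - w)) = hmon I \<alpha> \<beta> (\<lambda>i. coeff (p i) e)" for \<alpha>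
        using degree_hmon_le_coeff_hmon[of I p e \<alpha> \<beta>] assms(1) p(1) by (auto simp: w_def)
      have "degree R \<le> e * (D' - w)"
        unfolding R_def hderiv_def
      proof (intro degree_sum_le fin)
        fix \<alpha> assume \<alpha>: "\<alpha> \<in> exps I D"
        show "degree ([:c \<alpha>:] * hmon I \<alpha> \<beta> p) \<le> e * (D' - w)"
        proof (cases "c \<alpha> = 0")
          case False
          have "degree ([:c \<alpha>:] * hmon I \<alpha> \<beta> p) \<le> e * (sum \<alpha> I - w)"
            using hp(1)[of \<alpha>] by (simp add: False)
          also have "\<dots> \<le> e * (D' - w)"
            using max[OF \<alpha> False] by (intro mult_le_mono diff_le_mono) auto
          finally show ?thesis .
        qed simp
      qed
      also have "e * (D' - w) \<le> e * (D - w)"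
        using \<open>D' \<le> D\<close> by (intro mult_le_mono diff_le_mono) auto
      \<comment> \<open>Each of the \<open>q * e\<close> parameters is a zero of multiplicity at
        least \<open>m - w\<close>, so the zeros outnumber the degree.\<close>
      also have "\<dots> < e * ((m - w) * q)"
        using mult[of w] \<beta> True \<open>D' \<le> D\<close> assms(4) by (simp add: w_def)
      finally have deg: "degree R < (m - sum \<beta> I) * card S"
        by (simp add: assms(5) w_def mult_ac)
      have "vanishes I D c m (\<lambda>i. poly (p i) t)" if t: "t \<in> S" for t
      proof -
        obtain x where "x \<in> K" "\<forall>i\<in>I. x i = poly (p i) t" using p(3)[OF t] by blast
        with van[of x] show ?thesis
          using vanishes_cong[of I x "\<lambda>i. poly (p i) t"] by auto
      qed
      with deg have "R = 0"
        unfolding R_def using assms(1,2) by (intro hderiv_curve_eq_0) auto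
      then have "0 = coeff R (e * (D' - w))" by simp
      also have "\<dots> = (\<Sum>\<alpha>\<in>exps I D. coeff ([:c \<alpha>:] * hmon I \<alpha> \<beta> p) (e * (D' - w)))"
        by (simp add: R_def hderiv_def coeff_sum)
      also have "\<dots> = (\<Sum>\<alpha>\<in>exps I D. lead \<alpha> * hmon I \<alpha> \<beta> (\<lambda>i. coeff (p i) e))"
      proof (rule sum.cong[OF refl])
        fix \<alpha> assume \<alpha>: "\<alpha> \<in> exps I D"
        show "coeff ([:c \<alpha>:] * hmon I \<alpha> \<beta> p) (e * (D' - w)) =
            lead \<alpha> * hmon I \<alpha> \<beta> (\<lambda>i. coeff (p i) e)"
        proof (cases "sum \<alpha> I = D'")
          case True
          then show ?thesis using hp(2)[of \<alpha>] by (simp add: lead_def)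
        next
          case False
          show ?thesis
          proof (cases "c \<alpha> = 0")
            case True
            then show ?thesis by (simp add: lead_def)
          next
            case nz: False
            have "sum \<alpha> I < D'" using max[OF \<alpha> nz] False by simp
            show ?thesis
            \<comment> \<open>If \<open>sum \<alpha> I < w\<close>, truncation makes the degree
              bound 0, which is not below \<open>e * (D' - w)\<close> when \<open>D' = w\<close>;
              there the derivative itself is zero.\<close>
            proof (cases "sum \<alpha> I < w")
              case True
              then have "\<not> (\<forall>i\<in>I. \<beta> i \<le> \<alpha> i)" using sum_mono[of I \<beta> \<alpha>] by (fastforce simp: w_def)
              then obtain i where "i \<in> I" "\<alpha> i < \<beta> i" by (auto simp: not_le)
              then show ?thesis by (simp add: hmon_eq_0[where i = i] assms(1))
            next
              case False
              then have "e * (sum \<alpha> I - w) < e * (D' - w)"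
                using \<open>sum \<alpha> I < D'\<close> assms(4) by auto
              then have "degree (hmon I \<alpha> \<beta> p) < e * (D' - w)"
                using hp(1)[of \<alpha>] by linarith
              then show ?thesis using \<open>sum \<alpha> I < D'\<close> by (simp add: coeff_eq_0 lead_def)
            qed
          qed
        qed
      qed
      also have "\<dots> = hderiv I D lead \<beta> (\<lambda>i. coeff (p i) e)" by (simp add: hderiv_def)
      also have "\<dots> = hderiv I D lead \<beta> s" by (rule hderiv_cong) (auto simp: p(2))
      finally show ?thesis by simp
    qed
  qed
  then have "lead \<alpha>0 = 0"
    using assms(1,2,7) \<alpha>0(1) by (intro vanishing_on_grid[of I S D M lead]) auto
  with \<alpha>0 show False by (simp add: lead_def)
qed

section \<open>The limit of quotients of binomial coefficients\<close>

lemma binomial_eq_pochhammer: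
  assumes "x \<ge> 1"
  shows "real ((x - 1 + n) choose n) = pochhammer (real x) n / fact n"
  using assms by (simp add: binomial_gbinomial gbinomial_pochhammer' of_nat_diff)

text \<open>Both binomial coefficients are polynomials of degree \<open>n\<close> in
  \<open>N\<close>, with leading coefficients \<open>A ^ n / fact n\<close> and
  \<open>B ^ n / fact n\<close>. Dividing by \<open>N ^ n\<close> and letting \<open>N\<close> grow
  compares these.\<close>

lemma power_le_if_binomial_le:
  fixes A B k n :: nat
  assumes "A \<ge> 1" "B \<ge> 1"
    and le: "\<And>N. N \<ge> 1 \<Longrightarrow> (N * A - 1 + n) choose n \<le> k * ((N * B - 1 + n) choose n)"
  shows "real A ^ n \<le> real k * real B ^ n"
proof -
  have poch: "pochhammer (real (Suc N * x)) n = real (Suc N) ^ n * (\<Prod>i<n. real x + real i * inverse (real (Suc N)))" for N x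
  proof -
    have "pochhammer (real (Suc N * x)) n = (\<Prod>i<n. real (Suc N * x) + real i)"
      by (simp add: pochhammer_prod atLeast0LessThan)
    also have "\<dots> = (\<Prod>i<n. real (Suc N) * (real x + real i * inverse (real (Suc N))))"
      by (intro prod.cong refl) (simp add: field_simps)
    finally show ?thesis by (simp add: prod.distrib)
  qed
  have lim: "(\<lambda>N. \<Prod>i<n. real x + real i * inverse (real (Suc N))) \<longlonglongrightarrow> real x ^ n" for x
  proof -
    have "(\<lambda>N. \<Prod>i<n. real x + real i * inverse (real (Suc N))) \<longlonglongrightarrow> (\<Prod>i<n. real x + real i * 0)"
      by (intro tendsto_intros LIMSEQ_inverse_real_of_nat)
    then show ?thesis by simp
  qed
  have "(\<Prod>i<n. real A + real i * inverse (real (Suc N))) \<le>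
      real k * (\<Prod>i<n. real B + real i * inverse (real (Suc N)))" for N
  proof -
    have "real ((Suc N * A - 1 + n) choose n) \<le> real k * real ((Suc N * B - 1 + n) choose n)"
      using le[of "Suc N"] by (simp flip: of_nat_mult)
    moreover have "Suc N * A \<ge> 1" "Suc N * B \<ge> 1" using assms by auto
    ultimately have "pochhammer (real (Suc N * A)) n \<le> real k * pochhammer (real (Suc N * B)) n"
      by (simp only: binomial_eq_pochhammer) (simp add: field_simps)
    then have "real (Suc N) ^ n * (\<Prod>i<n. real A + real i * inverse (real (Suc N))) \<le>
        real (Suc N) ^ n * (real k * (\<Prod>i<n. real B + real i * inverse (real (Suc N))))"
      unfolding poch by (simp only: mult_ac)
    then show ?thesis
      by (rule mult_left_le_imp_le) simp
  qed
  then show ?thesis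
    by (intro LIMSEQ_le[OF lim tendsto_mult[OF tendsto_const lim]]) blast
qed

subsection \<open>Finite subfields of the algebraic closure\<close>

text \<open>Multiplication by a nonzero \<open>x\<close> permutes the nonzero elements, so their
  product absorbs a power of \<open>x\<close>.\<close>

lemma power_card_eq_self:
  fixes x :: "'a::{field,finite}"
  shows "x ^ CARD('a) = x"
proof (cases "x = 0")
  case False
  have "bij_betw ((*) x) (- {0}) (- {0})"
    using False by (intro bij_betwI[where g = "\<lambda>y. y / x"]) auto
  then have "\<Prod>(- {0}) = (\<Prod>y\<in>- {0}. x * y)"
    by (rule prod.reindex_bij_betw[symmetric])
  also have "\<dots> = x ^ card (- {0::'a}) * \<Prod>(- {0})"
    by (simp add: prod.distrib)
  finally have "x ^ card (- {0::'a}) = 1" by simp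
  moreover have "CARD('a) = Suc (card (- {0::'a}))"
    using card.remove[of UNIV "0::'a"] by (simp add: Compl_eq_Diff_UNIV)
  ultimately show ?thesis by simp
qed (simp add: card_gt_0_iff)

lemma to_ac_power_card: "to_ac (x::'a::{field,finite}) ^ CARD('a) = to_ac x"
  by (simp flip: to_ac_power add: power_card_eq_self)

lemma card_ge_2: "CARD('a::{field,finite}) \<ge> 2"
proof -
  have "card {0, 1::'a} \<le> CARD('a)" by (intro card_mono) auto
  then show ?thesis by simp
qed

lemma of_nat_card_eq_0: "of_nat (CARD('a)) = (0::'a::{field,finite} alg_closure)"
proof -
  \<comment> \<open>Translation by 1 permutes the field, so the sum of all elements is unchanged
    when \<open>CARD('a)\<close> ones are added.\<close>
  have "bij_betw (\<lambda>x::'a. x + 1) UNIV UNIV"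
    by (intro bij_betwI[where g = "\<lambda>y. y - 1"]) auto
  then have "(\<Sum>x\<in>UNIV. x) = (\<Sum>x\<in>UNIV. x + 1 :: 'a)"
    by (rule sum.reindex_bij_betw[symmetric])
  then have "of_nat (CARD('a)) = (0::'a)" by (simp add: sum.distrib)
  then show ?thesis by (metis to_ac_0 to_ac_of_nat)
qed

text \<open>The polynomial \<open>(X + y)^q - X^q - y^q\<close> has degree less than \<open>q\<close>, so it is zero once it vanishes on the \<open>q\<close> elements of the base field. By symmetry this applies
  first to \<open>y\<close> in the base field and then to every \<open>y\<close>.\<close>

lemma add_power_card:
  fixes x y :: "'a::{field,finite} alg_closure"
  shows "(x + y) ^ CARD('a) = x ^ CARD('a) + y ^ CARD('a)"
proof -
  define q where "q = CARD('a)"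
  have "q > 0" using card_ge_2[where 'a = 'a] by (simp add: q_def)
  have step: "(u + y) ^ q = u ^ q + y ^ q"
    if y: "\<And>a::'a. (to_ac a + y) ^ q = to_ac a ^ q + y ^ q" for u y :: "'a alg_closure"
  proof -
    define h where "h = [:y, 1:] ^ q - (monom 1 q + [:y ^ q:])"
    have poly_h: "poly h v = (v + y) ^ q - (v ^ q + y ^ q)" for v
      by (simp add: h_def poly_monom add.commute)
    have "h = 0"
    proof (rule ccontr)
      assume "h \<noteq> 0"
      have "degree h \<le> q"
        unfolding h_def
        by (intro degree_diff_le degree_add_le degree_monom_le) (auto simp: degree_linear_power)
      \<comment> \<open>The two terms of degree \<open>q\<close> cancel, and the constant does not
        interfere because \<open>q > 0\<close>.\<close>
      moreover have "coeff h q = 0"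
        using degree_le_power_coeff_power[of "[:y, 1:]" 1 q] \<open>q > 0\<close>
        by (simp add: h_def coeff_pCons split: nat.splits)
      ultimately have "degree h < q"
        using \<open>h \<noteq> 0\<close> by (metis leading_coeff_0_iff order_le_imp_less_or_eq)
      moreover have "card (range (to_ac :: 'a \<Rightarrow> _)) \<le> card {v. poly h v = 0}"
        using poly_roots_finite[OF \<open>h \<noteq> 0\<close>] y by (intro card_mono) (auto simp: poly_h)
      then have "q \<le> degree h"
        using card_poly_roots_bound[OF \<open>h \<noteq> 0\<close>] by (simp add: card_image inj_to_ac q_def)
      ultimately show False by simp
    qed
    then show ?thesis using poly_h[of u] by simp
  qed
  have "(to_ac a + to_ac b) ^ q = to_ac a ^ q + to_ac b ^ q" for a b :: 'a
    unfolding q_def by (simp only: to_ac_power_card flip: to_ac_add)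
  then have "(u + to_ac b) ^ q = u ^ q + to_ac b ^ q" for u and b :: 'a
    by (rule step)
  then have "(to_ac a + y) ^ q = to_ac a ^ q + y ^ q" for a :: 'a
    by (simp add: add.commute)
  then show ?thesis unfolding q_def[symmetric] by (rule step)
qed

lemma add_power_card_power:
  fixes x y :: "'a::{field,finite} alg_closure"
  shows "(x + y) ^ (CARD('a) ^ k) = x ^ (CARD('a) ^ k) + y ^ (CARD('a) ^ k)"
proof (induction k)
  case (Suc k)
  have "z ^ (CARD('a) ^ Suc k) = (z ^ (CARD('a) ^ k)) ^ CARD('a)" for z :: "'a alg_closure"
    by (simp add: mult.commute flip: power_mult)
  then show ?case by (simp only: Suc add_power_card)
qed simp

lemma sum_power_card:
  fixes f :: "'i \<Rightarrow> 'a::{field,finite} alg_closure"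
  shows "(\<Sum>i\<in>A. f i) ^ CARD('a) = (\<Sum>i\<in>A. f i ^ CARD('a))"
  by (induction A rule: infinite_finite_induct)
    (auto simp: add_power_card power_0_left)

text \<open>The polynomial \<open>X^q - X\<close> has at most \<open>q\<close> roots, and the base
  field already supplies that many.\<close>

lemma fixed_by_power_card:
  fixes x :: "'a::{field,finite} alg_closure"
  assumes "x ^ CARD('a) = x"
  shows "x \<in> range to_ac"
proof -
  define p :: "'a alg_closure poly" where "p = monom 1 (CARD('a)) - monom 1 1"
  have q: "CARD('a) \<ge> 2" by (rule card_ge_2)
  have "coeff p (CARD('a)) = 1" using q by (simp add: p_def)
  then have "p \<noteq> 0" by auto
  have "degree p \<le> CARD('a)"
    unfolding p_def using q by (intro degree_diff_le order_trans[OF degree_monom_le]) auto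
  then have "card {v. poly p v = 0} \<le> card (range (to_ac :: 'a \<Rightarrow> _))"
    using card_poly_roots_bound[OF \<open>p \<noteq> 0\<close>] by (simp add: card_image inj_to_ac)
  moreover have "range to_ac \<subseteq> {v. poly p v = 0}"
    by (auto simp: p_def poly_monom to_ac_power_card)
  ultimately have "range to_ac = {v. poly p v = 0}"
    using poly_roots_finite[OF \<open>p \<noteq> 0\<close>] by (intro card_seteq) auto
  then show ?thesis using assms by (auto simp: p_def poly_monom)
qed

text \<open>The polynomial splits into linear factors, and a repeated factor would give a zero of
  \<open>pderiv p\<close>.\<close>

lemma card_eq_degree_if_separable:
  fixes p :: "'f::alg_closed_field poly"
  assumes "p \<noteq> 0" "\<And>x. poly (pderiv p) x \<noteq> 0"
  shows "card {x. poly p x = 0} = degree p"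
proof -
  obtain A where A: "size A = degree p" "p = smult (lead_coeff p) (\<Prod>x\<in>#A. [:-x, 1:])"
    using alg_closed_imp_factorization[OF assms(1)] by blast
  have "count A x \<le> 1" if "x \<in># A" for x
  proof (rule ccontr)
    assume "\<not> count A x \<le> 1"
    with that have "x \<in># A - {#x#}"
      by (simp add: not_le flip: count_greater_zero_iff)
    then obtain B where "A - {#x#} = add_mset x B"
      using multi_member_split by metis
    then have "A = add_mset x (add_mset x B)"
      using that by (metis insert_DiffM)
    then have "p = [:-x, 1:] * ([:-x, 1:] * smult (lead_coeff p) (\<Prod>x\<in>#B. [:-x, 1:]))"
      by (subst A(2)) (simp del: mult_pCons_left)
    then obtain g where "p = [:-x, 1:] * ([:-x, 1:] * g)" by blast
    then have "poly (pderiv p) x = 0"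
      by (simp add: pderiv_mult del: mult_pCons_left)
    then show False using assms(2) by simp
  qed
  then have "size A \<le> (\<Sum>x\<in>set_mset A. 1)"
    unfolding size_multiset_overloaded_eq by (intro sum_mono) auto
  moreover have "set_mset A \<subseteq> {x. poly p x = 0}"
  proof
    fix x assume "x \<in># A"
    then obtain B where "A = add_mset x B" by (metis multi_member_split)
    then have "poly (\<Prod>x\<in>#A. [:-x, 1:]) x = 0" by simp
    then show "x \<in> {x. poly p x = 0}" by (subst A(2)) simp
  qed
  then have "card (set_mset A) \<le> card {x. poly p x = 0}"
    using poly_roots_finite[OF assms(1)] by (intro card_mono) auto
  ultimately show ?thesis
    using card_poly_roots_bound[OF assms(1)] A(1) by simp
qed

text \<open>This set is the field with \<open>q^r\<close> elements, realised inside the algebraic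
  closure. The polynomial \<open>X^(q^r) - X\<close> has derivative \<open>-1\<close>, hence only
  simple roots.\<close>

lemma card_fixed_by_power_card_power:
  assumes "r \<ge> 1"
  shows "card {x::'a::{field,finite} alg_closure. x ^ (CARD('a) ^ r) = x} = CARD('a) ^ r"
proof -
  define Q where "Q = CARD('a) ^ r"
  define p :: "'a alg_closure poly" where "p = monom 1 Q - monom 1 1"
  have "Q > 1"
    unfolding Q_def using assms card_ge_2[where 'a = 'a] by (intro one_less_power) auto
  then have deg: "degree p = Q"
    using degree_add_eq_left[of "- monom 1 1" "monom 1 Q :: 'a alg_closure poly"]
    by (simp add: p_def degree_monom_eq)
  have "of_nat Q = (0::'a alg_closure)"
    unfolding Q_def using assms by (simp add: of_nat_card_eq_0 zero_power)
  then have "pderiv p = -1"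
    by (simp add: p_def pderiv_diff pderiv_monom)
  moreover have "p \<noteq> 0" using deg \<open>Q > 1\<close> by auto
  ultimately have "card {x. poly p x = 0} = Q"
    using card_eq_degree_if_separable[of p] deg by simp
  then show ?thesis by (simp add: p_def poly_monom Q_def)
qed

subsection \<open>Kakeya sets\<close>

text \<open>The Kakeya property speaks of dimension exactly \<open>r\<close>, while the space of
  trace vectors may be smaller. A basis \<open>B\<close> of \<open>L\<close> yields
  \<open>CARD('a) ^ card B\<close> distinct elements of \<open>L\<close>, so
  \<open>card B \<le> r\<close>, and \<open>B\<close> extends to \<open>r\<close> independent
  vectors.\<close>

lemma subspace_extend_of_card_le:
  fixes L :: "('a::{field,finite} ^ 'n) set"
  assumes L: "vec.subspace L" and "card L \<le> CARD('a) ^ r" "r \<le> CARD('n)"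
  obtains L' where "L \<subseteq> L'" "vec.subspace L'" "vec.dim L' = r"
proof -
  obtain B where B: "B \<subseteq> L" "vec.independent B" "L \<subseteq> vec.span B"
    by (rule vec.basis_exists[of L])
  have finB: "finite B" by simp
  define F where "F = (\<lambda>f. \<Sum>b\<in>B. f b *s b)"
  have "F ` PiE B (\<lambda>_. UNIV) \<subseteq> L"
    using B(1) L by (auto simp: F_def intro!: vec.subspace_sum vec.subspace_scale)
  moreover have "inj_on F (PiE B (\<lambda>_. UNIV))"
  proof (rule inj_onI)
    fix f g assume fg: "f \<in> B \<rightarrow>\<^sub>E UNIV" "g \<in> B \<rightarrow>\<^sub>E UNIV" "F f = F g"
    have "(\<Sum>b\<in>B. (f b - g b) *s b) = 0"
      using fg(3) by (simp add: F_def vec.scale_left_diff_distrib sum_subtractf)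
    then have "\<forall>b\<in>B. f b - g b = 0"
      using vec.independentD[OF B(2) finB order_refl, of "\<lambda>b. f b - g b"] by blast
    then show "f = g" using fg(1,2) by (intro PiE_ext) auto
  qed
  ultimately have "card (B \<rightarrow>\<^sub>E (UNIV :: 'a set)) \<le> card L"
    by (metis card_image card_mono finite_code)
  then have "CARD('a) ^ card B \<le> CARD('a) ^ r"
    using assms(2) by (simp add: card_PiE)
  then have "card B \<le> r"
    using card_ge_2[where 'a = 'a] by (simp add: power_le_imp_le_exp)
  obtain B' where B': "B \<subseteq> B'" "vec.independent B'" "UNIV \<subseteq> vec.span B'"
    using vec.maximal_independent_subset_extend[of B UNIV] B(2) by auto
  have "card B' = vec.dim (UNIV :: ('a ^ 'n) set)"
    using B'(2,3) by (intro vec.basis_card_eq_dim) auto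
  then have "card B' = CARD('n)" by (simp add: card_cart_basis)
  then obtain C where C: "B \<subseteq> C" "C \<subseteq> B'" "card C = r"
    using exists_subset_between[of B r B'] \<open>card B \<le> r\<close> assms(3) B'(1) by auto
  show ?thesis
  proof
    show "L \<subseteq> vec.span C" using B(3) vec.span_mono[OF C(1)] by blast
    show "vec.dim (vec.span C) = r"
      using C vec.dim_span_eq_card_independent vec.independent_mono[OF B'(2)] by blast
  qed simp
qed


text \<open>The curve is a translate of the traces of \<open>s i ^ q * t\<close>. Its term of degree
  \<open>q ^ (r - 1)\<close> has coefficient \<open>(s i ^ q) ^ (q ^ (r - 1)) = s i\<close>; this is
  why \<open>s i\<close> enters through its \<open>q\<close>-th power.\<close>

lemma kakeya_curves:
  fixes K :: "('a::{field,finite} ^ 'n) set" and s :: "'n \<Rightarrow> 'a alg_closure"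
  assumes "1 \<le> r" "r \<le> CARD('n)" "vec.kakeya_set r K"
    and s: "\<And>i. s i ^ (CARD('a) ^ r) = s i"
  shows "\<exists>p :: 'n \<Rightarrow> 'a alg_closure poly.
    (\<forall>i. degree (p i) \<le> CARD('a) ^ (r - 1) \<and> coeff (p i) (CARD('a) ^ (r - 1)) = s i) \<and>
    (\<forall>t. t ^ (CARD('a) ^ r) = t \<longrightarrow> (\<exists>x\<in>K. \<forall>i. to_ac (x $ i) = poly (p i) t))"
proof -
  define q where "q = CARD('a)"
  define E :: "'a alg_closure set" where "E = {x. x ^ (q ^ r) = x}"
  have q: "q \<ge> 2" unfolding q_def by (rule card_ge_2)
  have s_E: "s i \<in> E" for i using s by (simp add: E_def q_def)
  have E_mult: "x * y \<in> E" if "x \<in> E" "y \<in> E" for x y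
    using that by (simp add: E_def power_mult_distrib)
  have E_add: "x + y \<in> E" if "x \<in> E" "y \<in> E" for x y
    using that by (simp add: E_def q_def add_power_card_power)
  have E_pow: "x ^ k \<in> E" if "x \<in> E" for x k
  proof -
    have "(x ^ k) ^ (q ^ r) = (x ^ (q ^ r)) ^ k"
      by (simp add: mult.commute flip: power_mult)
    with that show ?thesis by (simp add: E_def)
  qed
  have to_ac_pow: "to_ac a ^ (q ^ k) = to_ac a" for a :: 'a and k
    by (induction k) (simp_all add: power_mult q_def to_ac_power_card)
  have E_to_ac: "to_ac a \<in> E" for a :: 'a
    by (simp add: E_def to_ac_pow)
  define tr :: "'a alg_closure \<Rightarrow> 'a alg_closure" where "tr = (\<lambda>x. \<Sum>k<r. x ^ (q ^ k))"
  have tr_add: "tr (x + y) = tr x + tr y" for x y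
    by (simp add: tr_def q_def add_power_card_power sum.distrib)
  have tr_scale: "tr (to_ac a * x) = to_ac a * tr x" for a x
    by (simp add: tr_def power_mult_distrib to_ac_pow sum_distrib_left)
  have tr_range: "tr x \<in> range to_ac" if "x \<in> E" for x
  proof (rule fixed_by_power_card)
    \<comment> \<open>Raising to the power \<open>q\<close> shifts the summands cyclically, because
      \<open>x ^ (q ^ r) = x\<close> on \<open>E\<close>.\<close>
    have "tr x ^ CARD('a) = (\<Sum>k<r. x ^ (q ^ Suc k))"
      by (simp add: tr_def sum_power_card q_def mult.commute flip: power_mult)
    also have "x ^ (q ^ 0) + (\<Sum>k<r. x ^ (q ^ Suc k)) = (\<Sum>k<Suc r. x ^ (q ^ k))"
      by (rule sum.lessThan_Suc_shift[symmetric])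
    then have "(\<Sum>k<r. x ^ (q ^ Suc k)) = tr x"
      using that by (simp add: tr_def E_def)
    finally show "tr x ^ CARD('a) = tr x" .
  qed
  define v where "v = (\<lambda>t. \<chi> i. of_ac (tr (s i ^ q * t)))"
  \<comment> \<open>\<open>of_ac\<close> is known to invert \<open>to_ac\<close> only on the range
    of \<open>to_ac\<close>, hence the restriction to \<open>E\<close>.\<close>
  have v: "to_ac (v t $ i) = tr (s i ^ q * t)" if "t \<in> E" for t i
    using tr_range[OF E_mult[OF E_pow[OF s_E] that]] by (simp add: v_def to_ac_of_ac)
  have vec_eqI: "x = y" if "\<And>i. to_ac (x $ i) = to_ac (y $ i)" for x y :: "'a ^ 'n"
    using that by (simp add: vec_eq_iff)
  have "vec.subspace (v ` E)"
  proof (rule vec.subspaceI)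
    have "0 \<in> E" using q by (simp add: E_def power_0_left)
    then have "v 0 = 0"
      using q by (intro vec_eqI) (simp add: v tr_def power_0_left)
    then show "0 \<in> v ` E" using \<open>0 \<in> E\<close> by force
  next
    fix x y assume "x \<in> v ` E" "y \<in> v ` E"
    then obtain t u where tu: "t \<in> E" "u \<in> E" "x = v t" "y = v u" by auto
    have "v t + v u = v (t + u)"
      using tu(1,2) by (intro vec_eqI) (simp add: v E_add distrib_left tr_add)
    then show "x + y \<in> v ` E" using tu E_add by auto
  next
    fix c x assume "x \<in> v ` E"
    then obtain t where t: "t \<in> E" "x = v t" by auto
    have "tr (s i ^ q * (to_ac c * t)) = to_ac c * tr (s i ^ q * t)" for i
      by (simp add: mult.left_commute flip: tr_scale)
    then have "c *s v t = v (to_ac c * t)"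
      using t(1) by (intro vec_eqI) (simp add: v E_mult E_to_ac)
    then show "c *s x \<in> v ` E" using t E_mult E_to_ac by auto
  qed
  moreover have cardE: "card E = q ^ r"
    unfolding E_def q_def using assms(1) by (rule card_fixed_by_power_card_power)
  then have "finite E" using q by (intro card_ge_0_finite) simp
  then have "card (v ` E) \<le> q ^ r"
    using card_image_le[of E v] cardE by simp
  ultimately obtain L where L: "v ` E \<subseteq> L" "vec.subspace L" "vec.dim L = r"
    using subspace_extend_of_card_le[of "v ` E" r] assms(2) unfolding q_def by blast
  then obtain b where b: "(+) b ` L \<subseteq> K"
    using assms(3) unfolding vec.kakeya_set_def by blast
  define p where "p = (\<lambda>i. [:to_ac (b $ i):] + (\<Sum>k<r. monom ((s i ^ q) ^ (q ^ k)) (q ^ k)))"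
  have "degree (p i) \<le> q ^ (r - 1)" for i
    unfolding p_def
  proof (intro degree_add_le degree_sum_le)
    fix k assume "k \<in> {..<r}"
    then have "q ^ k \<le> q ^ (r - 1)" using q by (intro power_increasing) auto
    then show "degree (monom ((s i ^ q) ^ (q ^ k)) (q ^ k)) \<le> q ^ (r - 1)"
      by (rule order_trans[OF degree_monom_le])
  qed auto
  moreover have "coeff (p i) (q ^ (r - 1)) = s i" for i
  proof -
    have "coeff [:to_ac (b $ i):] (q ^ (r - 1)) = 0"
      using q by (intro coeff_eq_0) simp
    then have "coeff (p i) (q ^ (r - 1)) =
        (\<Sum>k<r. if k = r - 1 then (s i ^ q) ^ (q ^ k) else 0)"
      using q by (simp add: p_def coeff_sum)
    also have "\<dots> = (s i ^ q) ^ (q ^ (r - 1))"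
      using assms(1) by simp
    also have "\<dots> = s i ^ (q ^ Suc (r - 1))"
      by (simp flip: power_mult)
    also have "\<dots> = s i" using s assms(1) by (simp add: q_def)
    finally show ?thesis .
  qed
  moreover have "\<exists>x\<in>K. \<forall>i. to_ac (x $ i) = poly (p i) t" if "t \<in> E" for t
  proof (intro bexI allI)
    show "b + v t \<in> K" using b L(1) that by auto
    show "to_ac ((b + v t) $ i) = poly (p i) t" for i
      using that by (simp add: p_def v tr_def poly_sum poly_monom power_mult_distrib)
  qed
  ultimately show ?thesis
    unfolding q_def E_def by (intro exI[of _ p]) auto
qed

section \<open>Choice of parameters and passage to the limit\<close>

theorem theorem1:
  fixes K :: "(('a::{field,finite}) ^ 'n) set"
    and n r q :: nat
  assumes "CARD('a) = q" and "CARD('n) = n"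
    and "1 \<le> r" and "r \<le> n"
    and "vec.kakeya_set r K"
  shows "real (card K) \<ge> (real q ^ (r + 1) / (real q ^ r + real q - 1)) ^ n
    \<and> (real q ^ (r + 1) / (real q ^ r + real q - 1)) ^ n
        = (1 + (real q - 1) * real q powi (- int r)) powi (- int n) * real q ^ n"
proof -
  have q: "q \<ge> 2" using card_ge_2[where 'a = 'a] assms(1) by simp
  define S :: "'a alg_closure set" where "S = {x. x ^ (q ^ r) = x}"
  define A where "A = q ^ (r + 1)"
  define B where "B = q ^ r + q - 1"
  have "A \<ge> 1" "B \<ge> 1" using q by (auto simp: A_def B_def)
  have cardS: "card S = q ^ r"
    unfolding S_def using card_fixed_by_power_card_power[where 'a = 'a, OF assms(3)] assms(1) by simp
  then have finS: "finite S" using q by (intro card_ge_0_finite) simp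
  \<comment> \<open>\<open>K\<close> is moved into the algebraic closure, where the curves
    live.\<close>
  define K' where "K' = (\<lambda>x i. to_ac (x $ i)) ` K"
  have "card K' \<le> card K" unfolding K'_def by (intro card_image_le) simp
  have "(N * A - 1 + n) choose n \<le> card K * ((N * B - 1 + n) choose n)" if "N \<ge> 1" for N
  proof -
    have "card (exps (UNIV :: 'n set) (N * A - 1)) \<le> card K' * card (exps (UNIV :: 'n set) (N * B - 1))"
    proof (rule card_exps_le_of_curves)
      show "finite (UNIV :: 'n set)" "finite S" "finite K'" "q ^ (r - 1) \<ge> 1"
        using finS q by (auto simp: K'_def)
      show "card S = q * q ^ (r - 1)"
        using cardS assms(3) by (simp flip: power_Suc)
      show "\<exists>p :: 'n \<Rightarrow> 'a alg_closure poly.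
          (\<forall>i\<in>UNIV. degree (p i) \<le> q ^ (r - 1) \<and> coeff (p i) (q ^ (r - 1)) = s i) \<and>
          (\<forall>t\<in>S. \<exists>x\<in>K'. \<forall>i\<in>UNIV. x i = poly (p i) t)" if "\<forall>i\<in>UNIV. s i \<in> S" for s
        using kakeya_curves[of r K s] that assms by (fastforce simp: S_def K'_def)
      \<comment> \<open>\<open>N * A - 1\<close> is the largest degree below
        \<open>N * q * card S = N * A\<close>.\<close>
      have "N * A - 1 < N * A" using \<open>A \<ge> 1\<close> that by simp
      then show "N * A - 1 < N * q * card S" by (simp add: cardS A_def)
      show "N * A - 1 - w < (N * B - w) * q" if "w < N * q" for w
      proof -
        \<comment> \<open>With \<open>d = q - 1\<close>, \<open>B\<close> is chosen so that
          \<open>B * q = A + q * d\<close>. Then \<open>w \<le> N * q\<close> gives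
          \<open>(N * B - w) * q \<ge> N * A - w\<close>.\<close>
        obtain d where d: "q = Suc d" using q by (cases q) auto
        have "w * d \<le> N * q * d" using that by simp
        moreover have "N * B * q = N * A + N * q * d"
          by (simp add: A_def B_def d algebra_simps)
        moreover have "w * q = w * d + w" by (simp add: d)
        moreover have "N * q \<le> N * A" using q by (simp add: A_def)
        ultimately show ?thesis
          using that unfolding diff_mult_distrib by linarith
      qed
    qed
    also have "\<dots> \<le> card K * card (exps (UNIV :: 'n set) (N * B - 1))"
      using \<open>card K' \<le> card K\<close> by simp
    finally show ?thesis by (simp add: card_exps assms(2))
  qed
  then have le: "real A ^ n \<le> real (card K) * real B ^ n"
    using \<open>A \<ge> 1\<close> \<open>B \<ge> 1\<close> by (intro power_le_if_binomial_le)
  have B_real: "real B = real q ^ r + real q - 1"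
    using q by (simp add: B_def of_nat_diff)
  have A_real: "real A = real q ^ (r + 1)" by (simp add: A_def)
  have "(real A / real B) ^ n \<le> real (card K)"
    using le \<open>B \<ge> 1\<close> by (simp add: power_divide divide_le_eq)
  moreover have "(real A / real B) ^ n =
      (1 + (real q - 1) * real q powi (- int r)) powi (- int n) * real q ^ n"
  proof -
    have "1 + (real q - 1) * real q powi (- int r) = real B / real q ^ r"
      using q by (simp add: B_real power_int_minus field_simps)
    then have "(1 + (real q - 1) * real q powi (- int r)) powi (- int n) * real q ^ n =
        (real q ^ r / real B * real q) ^ n"
      by (simp add: power_int_minus flip: power_inverse power_mult_distrib)
    also have "real q ^ r / real B * real q = real A / real B"
      by (simp add: A_real)
    finally show ?thesis by simp
  qed
  ultimately show ?thesis unfolding A_real B_real by blast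
qed

end
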